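(* Let $t$ be a positive integer. If a graph $G$ has a circular drawing whose crossing graph has no $K_t$-minor, then $G$ does not contain $K_{2,4t}$ as a topological minor (that is, no subgraph of $G$ is isomorphic to a subdivision of $K_{2,4t}$).
   Context: A circular drawing of a graph $G$ places the vertices of $G$ at distinct points on a circle and draws each edge as the straight line segment between its endpoints. Two edges cross if their segments intersect at a point that is not an endpoint of either. The crossing graph of a circular drawing $D$ of $G$ is the graph with vertex set $E(G)$ in which two edges are adjacent if and only if they cross in $D$. *)

theory Defs
  imports "HOL-Analysis.Analysis" "Graph_Theory.Graph_Theory"
begin

text \<open>
  A (possibly infinite) simple undirected graph is a symmetric loop-free relation on its vertices,
  i.e. a \<^typ>\<open>'a pair_pre_digraph\<close> satisfying \<^const>\<open>pair_bidirected_digraph\<close>. The two arcs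
  \<open>(u, v)\<close> and \<open>(v, u)\<close> represent one undirected edge \<open>{u, v}\<close>.
\<close>

definition edge_set :: "'a pair_pre_digraph \<Rightarrow> 'a set set" where
  "edge_set G = {{u, v} | u v. (u, v) \<in> parcs G}"

definition circular_drawing :: "'a pair_pre_digraph \<Rightarrow> ('a \<Rightarrow> complex) \<Rightarrow> bool" where
  "circular_drawing G pos \<longleftrightarrow>
     inj_on pos (pverts G) \<and> (\<exists>c r. r > 0 \<and> pos ` pverts G \<subseteq> sphere c r)"

text \<open>
  For an edge \<open>e = {u, v}\<close>, the convex hull of \<open>pos ` e\<close> is \<open>closed_segment (pos u) (pos v)\<close>.
\<close>

definition crosses :: "('a \<Rightarrow> complex) \<Rightarrow> 'a set \<Rightarrow> 'a set \<Rightarrow> bool" where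
  "crosses pos e f \<longleftrightarrow>
     (\<exists>p \<in> convex hull (pos ` e) \<inter> convex hull (pos ` f). p \<notin> pos ` e \<and> p \<notin> pos ` f)"

definition crossing_graph :: "'a pair_pre_digraph \<Rightarrow> ('a \<Rightarrow> complex) \<Rightarrow> 'a set pair_pre_digraph" where
  "crossing_graph G pos =
     \<lparr> pverts = edge_set G,
       parcs = {(e, f). e \<in> edge_set G \<and> f \<in> edge_set G \<and> e \<noteq> f \<and> crosses pos e f} \<rparr>"

text \<open>
  \<open>B v\<close> is the branch set of \<open>v\<close>. It is nonempty because \<^const>\<open>Digraph_Component.connected\<close>
  excludes the graph without vertices.
\<close>

definition minor :: "'b pair_pre_digraph \<Rightarrow> 'a pair_pre_digraph \<Rightarrow> bool" where
  "minor H G \<longleftrightarrow>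
     (\<exists>B :: 'b \<Rightarrow> 'a set.
        (\<forall>v \<in> pverts H. B v \<subseteq> pverts G \<and>
           Digraph_Component.connected (induce_subgraph (with_proj G) (B v))) \<and>
        (\<forall>u \<in> pverts H. \<forall>v \<in> pverts H. u \<noteq> v \<longrightarrow> B u \<inter> B v = {}) \<and>
        (\<forall>(u, v) \<in> parcs H. \<exists>x \<in> B u. \<exists>y \<in> B v. (x, y) \<in> parcs G))"

text \<open>
  A subdivision \<open>D\<close> of \<open>H\<close> lives on the same vertex type as \<open>H\<close>; taking this type to be
  \<^typ>\<open>nat\<close> guarantees that a finite \<open>H\<close> never runs out of fresh subdivision vertices.
\<close>

definition topological_minor :: "nat pair_pre_digraph \<Rightarrow> 'a pair_pre_digraph \<Rightarrow> bool" where
  "topological_minor H G \<longleftrightarrow>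
     (\<exists>D S. subdivision_pair H D \<and> subgraph (with_proj S) (with_proj G) \<and>
        digraph_iso (with_proj D) (with_proj S))"

end

theory Submission
  imports Defs
begin

text \<open>
  Let \<open>x\<close> and \<open>y\<close> be the two hubs of the subdivided \<open>K\<^sub>2\<^sub>,\<^sub>4\<^sub>t\<close> and measure angles on the circle from \<open>x\<close>.
  After a reflection, at least \<open>2t\<close> of the \<open>4t\<close> paths from \<open>x\<close> to \<open>y\<close> have their first inner vertex
  before \<open>y\<close>. Group these into \<open>t\<close> pairs. For a pair \<open>P, Q\<close> with first inner vertices \<open>u\<^sub>P < u\<^sub>Q\<close>, take
  the component of the chord \<open>x u\<^sub>Q\<close> in the crossing graph of \<open>P \<union> Q\<close>. It has a vertex at or after
  \<open>y\<close>: otherwise its last vertex \<open>M\<close> lies before \<open>y\<close>, and neither path can jump over \<open>M\<close> without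
  crossing the component, so both contain \<open>M\<close>. Two such components cross: if \<open>u < u'\<close> are the
  ends of their chords at \<open>x\<close>, the chord \<open>x u'\<close> separates \<open>u\<close> from everything at or after \<open>y\<close>.
  The \<open>t\<close> components are therefore the branch sets of a \<open>K\<^sub>t\<close>-minor.
\<close>

section \<open>Chords of a circle\<close>

text \<open>Combinatorial stand-in for crossing chords: their ends alternate along the circle cut
  open. The path arguments use only this relation; \<open>interleave_imp_crosses\<close> leads back
  to the drawing.\<close>

definition interleave :: "('a \<Rightarrow> real) \<Rightarrow> 'a set \<Rightarrow> 'a set \<Rightarrow> bool" where
  "interleave \<theta> e f \<longleftrightarrow>
     (\<exists>a b c d. \<theta> a < \<theta> b \<and> \<theta> b < \<theta> c \<and> \<theta> c < \<theta> d \<and>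
        (e = {a, c} \<and> f = {b, d} \<or> e = {b, d} \<and> f = {a, c}))"

lemma interleave_sym: "interleave \<theta> e f \<Longrightarrow> interleave \<theta> f e"
  unfolding interleave_def by blast

lemma interleave_imp_neq: "interleave \<theta> e f \<Longrightarrow> e \<noteq> f"
  unfolding interleave_def by (auto simp: doubleton_eq_iff)

text \<open>The left side is twice the signed area of the triangle \<open>cis a\<close>,
  \<open>cis b\<close>, \<open>cis c\<close>. The product form reveals its sign.\<close>

lemma sin_sum_triangle:
  fixes a b c :: real
  shows "sin (b - a) + sin (c - b) + sin (a - c) =
    4 * sin ((b - a) / 2) * sin ((c - b) / 2) * sin ((c - a) / 2)"
proof -
  define u v where "u = (b - a) / 2" and "v = (c - b) / 2"
  have e: "b - a = 2 * u" "c - b = 2 * v" "a - c = - (2 * (u + v))" "(c - a) / 2 = u + v"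
    by (auto simp: u_def v_def field_simps)
  have "sin (2 * u) + sin (2 * v) - sin (2 * (u + v)) = 4 * sin u * sin v * sin (u + v)"
  proof -
    have "sin (2 * u) + sin (2 * v) - sin (2 * (u + v)) =
       2 * sin u * cos u * (1 - cos (2 * v)) + 2 * sin v * cos v * (1 - cos (2 * u))"
      using sin_double[of u] sin_double[of v] sin_add[of "2 * u" "2 * v"]
      by (simp add: distrib_left) (simp add: algebra_simps)
    also have "\<dots> = 2 * sin u * cos u * (2 * (sin v)\<^sup>2) + 2 * sin v * cos v * (2 * (sin u)\<^sup>2)"
      by (simp add: cos_double_sin)
    also have "\<dots> = 4 * sin u * sin v * sin (u + v)"
      by (simp add: sin_add power2_eq_square algebra_simps)
    finally show ?thesis .
  qed
  then show ?thesis unfolding e sin_minus by simp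
qed

lemma sin_sum_triangle_pos:
  fixes a b c :: real
  assumes "a < b" "b < c" "c < a + 2 * pi"
  shows "0 < sin (b - a) + sin (c - b) + sin (a - c)"
  unfolding sin_sum_triangle
  using assms by (intro mult_pos_pos sin_gt_zero) auto

text \<open>
  The weights are the areas of the four triangles spanned by the points, i.e. the coefficients of
  the affine dependence of four points in the plane.
\<close>
lemma cis_chords_intersect:
  fixes a b c d :: real
  assumes "a < b" "b < c" "c < d" "d < a + 2 * pi"
  shows "\<exists>p. p \<in> open_segment (cis a) (cis c) \<and> p \<in> open_segment (cis b) (cis d)"
proof -
  define T where "T p q r = sin (q - p) + sin (r - q) + sin (p - r)" for p q r :: real
  have pos: "0 < T b c d" "0 < T a c d" "0 < T a b d" "0 < T a b c"
    unfolding T_def using assms by (auto intro!: sin_sum_triangle_pos)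
  \<comment> \<open>Both sums are twice the area of the quadrilateral, cut along the diagonal
    \<open>bd\<close> on the left and \<open>ac\<close> on the right.\<close>
  have T_eq: "T b c d + T a b d = T a c d + T a b c"
    unfolding T_def using sin_minus[of "c - a"] sin_minus[of "d - b"] by simp
  have dep: "T b c d *\<^sub>R cis a + T a b d *\<^sub>R cis c = T a c d *\<^sub>R cis b + T a b c *\<^sub>R cis d"
    by (simp add: complex_eq_iff T_def sin_diff algebra_simps)
  define S where "S = T b c d + T a b d"
  have S: "S > 0" "S = T a c d + T a b c" using pos T_eq by (auto simp: S_def)
  \<comment> \<open>Dividing both sides of \<open>dep\<close> by the common weight \<open>S\<close>
    gives one point written as a convex combination on each chord.\<close>
  define p where "p = (1 / S) *\<^sub>R (T b c d *\<^sub>R cis a + T a b d *\<^sub>R cis c)"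
  have p1: "p = (1 - T a b d / S) *\<^sub>R cis a + (T a b d / S) *\<^sub>R cis c"
    using S(1) by (simp add: p_def S_def field_simps scaleR_add_right)
  have p2: "p = (1 - T a b c / S) *\<^sub>R cis b + (T a b c / S) *\<^sub>R cis d"
    using S(1) unfolding p_def dep S(2) by (simp add: field_simps scaleR_add_right)
  have neq: "cis a \<noteq> cis c" "cis b \<noteq> cis d"
  proof -
    show "cis a \<noteq> cis c"
    proof
      assume "cis a = cis c"
      then have "T a b c = 0" by (simp add: T_def sin_diff complex_eq_iff)
      then show False using pos by simp
    qed
    show "cis b \<noteq> cis d"
    proof
      assume "cis b = cis d"
      then have "T a b d = 0" by (simp add: T_def sin_diff complex_eq_iff)
      then show False using pos by simp
    qed
  qed
  have "0 < T a b d / S" "T a b d / S < 1" "0 < T a b c / S" "T a b c / S < 1"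
    using pos S by (auto simp: S_def)
  then show ?thesis using p1 p2 neq unfolding in_segment by blast
qed

text \<open>The sign \<open>s\<close> is the orientation in which angles are measured, so that the
  lemma also covers the reflected circle. The range of the angles keeps the four points within one
  turn.\<close>

lemma interleave_imp_crosses:
  fixes s :: real
  assumes "interleave \<theta> e f" and s: "s = 1 \<or> s = -1"
    and range: "\<And>v. v \<in> e \<union> f \<Longrightarrow> 0 \<le> \<theta> v \<and> \<theta> v < 2 * pi"
    and pos: "\<And>v. v \<in> e \<union> f \<Longrightarrow> pos v = z + w * cis (s * \<theta> v)" and "w \<noteq> 0"
  shows "crosses pos e f"
proof -
  obtain a b c d where o: "\<theta> a < \<theta> b" "\<theta> b < \<theta> c" "\<theta> c < \<theta> d"
    and ef: "e = {a, c} \<and> f = {b, d} \<or> e = {b, d} \<and> f = {a, c}"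
    using assms(1) unfolding interleave_def by blast
  have r: "0 \<le> \<theta> a" "\<theta> d < 2 * pi" using range ef by auto
  obtain p where p: "p \<in> open_segment (cis (s * \<theta> a)) (cis (s * \<theta> c))"
      "p \<in> open_segment (cis (s * \<theta> b)) (cis (s * \<theta> d))"
  proof (cases "s = 1")
    case True
    then show ?thesis
      using that cis_chords_intersect[of "\<theta> a" "\<theta> b" "\<theta> c" "\<theta> d"] o r by auto
  next
    case False
    then have "s = -1" using s by simp
    \<comment> \<open>Negating the angles reverses their order, so the points are listed from
      \<open>d\<close> to \<open>a\<close>.\<close>
    then show ?thesis
      using that cis_chords_intersect[of "- \<theta> d" "- \<theta> c" "- \<theta> b" "- \<theta> a"] o r
      by (auto simp: open_segment_commute)
  qed
  have move: "z + w * p \<in> open_segment (z + w * g) (z + w * h)"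
    if "p \<in> open_segment g h" for g h
    using that \<open>w \<noteq> 0\<close> unfolding in_segment
    by (force simp: algebra_simps scaleR_conv_of_real)
  have q: "z + w * p \<in> open_segment (pos a) (pos c)" "z + w * p \<in> open_segment (pos b) (pos d)"
    using p[THEN move] pos ef by auto
  then have "z + w * p \<in> convex hull {pos a, pos c} \<inter> convex hull {pos b, pos d}"
    "z + w * p \<notin> {pos a, pos c}" "z + w * p \<notin> {pos b, pos d}"
    by (auto simp: open_segment_def segment_convex_hull)
  then show ?thesis using ef unfolding crosses_def by auto
qed

text \<open>
  A chord that avoids all of \<open>C\<close> has each member of \<open>C\<close> on one side, and neighbours
  in the interleaving relation lie on the same side.
\<close>
lemma interleave_separated:
  assumes conn: "(\<lambda>e f. e \<in> C \<and> f \<in> C \<and> interleave \<theta> e f)\<^sup>*\<^sup>* e0 e1"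
    and "e0 \<in> C" and pair: "\<And>e. e \<in> C \<Longrightarrow> \<exists>p q. e = {p, q}"
    and "z0 \<in> e0" "\<theta> a < \<theta> z0" "\<theta> z0 < \<theta> b"
    and "z1 \<in> e1" "\<theta> z1 < \<theta> a \<or> \<theta> b < \<theta> z1"
  shows "\<exists>g \<in> C. interleave \<theta> g {a, b}"
proof (rule ccontr)
  assume no: "\<not> ?thesis"
  have same_side: "\<forall>v \<in> f. \<theta> a \<le> \<theta> v \<and> \<theta> v \<le> \<theta> b"
    if f_z: "f \<in> C" "z \<in> f" "\<theta> a < \<theta> z" "\<theta> z < \<theta> b" for f z
  proof -
    obtain z' where f: "f = {z, z'}" using pair[OF f_z(1)] f_z(2) by blast
    have "\<not> \<theta> z' < \<theta> a"
    proof
      assume "\<theta> z' < \<theta> a"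
      then have "interleave \<theta> {z', z} {a, b}" using that unfolding interleave_def by blast
      then show False using no that(1) f by (auto simp: insert_commute)
    qed
    moreover have "\<not> \<theta> b < \<theta> z'"
    proof
      assume "\<theta> b < \<theta> z'"
      then have "interleave \<theta> {z, z'} {a, b}" using that unfolding interleave_def by blast
      then show False using no that(1) f by auto
    qed
    ultimately show ?thesis using f that by auto
  qed
  have "\<forall>v \<in> e1. \<theta> a \<le> \<theta> v \<and> \<theta> v \<le> \<theta> b"
    using conn
  proof induction
    case base
    then show ?case using same_side assms by blast
  next
    case (step e f)
    then have "interleave \<theta> e f" "f \<in> C" by auto
    \<comment> \<open>One end of \<open>f\<close> lies strictly between the two ends of
      \<open>e\<close>, hence strictly between \<open>a\<close> and \<open>b\<close>.\<close>
    then obtain z where "z \<in> f" "\<theta> a < \<theta> z" "\<theta> z < \<theta> b"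
      using step.IH unfolding interleave_def by force
    then show ?case using \<open>f \<in> C\<close> same_side by blast
  qed
  then show False using assms by force
qed

section \<open>Components spanned by two paths\<close>

definition path_edges :: "'a list \<Rightarrow> 'a set set" where
  "path_edges xs = {{a, b} | a b. \<exists>ys zs. xs = ys @ a # b # zs}"

lemma path_edgesI: "xs = ys @ a # b # zs \<Longrightarrow> {a, b} \<in> path_edges xs"
  unfolding path_edges_def by blast

lemma path_edgesE:
  assumes "e \<in> path_edges xs"
  obtains ys a b zs where "e = {a, b}" "xs = ys @ a # b # zs"
  using assms unfolding path_edges_def by blast

lemma path_edges_subset: "e \<in> path_edges xs \<Longrightarrow> e \<subseteq> set xs"
  by (auto elim!: path_edgesE)

lemma successively_iff_split:
  "successively P xs \<longleftrightarrow> (\<forall>ys a b zs. xs = ys @ a # b # zs \<longrightarrow> P a b)"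
proof
  assume "successively P xs"
  then show "\<forall>ys a b zs. xs = ys @ a # b # zs \<longrightarrow> P a b"
    by (auto simp: successively_append_iff)
next
  assume "\<forall>ys a b zs. xs = ys @ a # b # zs \<longrightarrow> P a b"
  then show "successively P xs"
  proof (induction xs rule: induct_list012)
    case (3 a b xs)
    have "successively P (b # xs)"
      using 3 by (metis append_Cons)
    moreover have "P a b" using 3(3) by (metis append_Nil)
    ultimately show ?case by simp
  qed auto
qed

text \<open>A discrete intermediate value theorem. The inequality at \<open>a\<close> is weak, so
  \<open>a\<close> may lie exactly on the level \<open>m\<close>.\<close>

lemma list_crosses_level:
  fixes \<theta> :: "'a \<Rightarrow> real"
  assumes "xs \<noteq> []" "\<theta> (hd xs) \<le> m" "m < \<theta> (last xs)"
  obtains ys a b zs where "xs = ys @ a # b # zs" "\<theta> a \<le> m" "m < \<theta> b"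
proof -
  have "\<exists>ys a b zs. xs = ys @ a # b # zs \<and> \<theta> a \<le> m \<and> m < \<theta> b"
    using assms
  proof (induction xs rule: induct_list012)
    case (3 a b xs)
    show ?case
    proof (cases "m < \<theta> b")
      case True
      then show ?thesis using 3(4) by (intro exI[of _ "[]"] exI[of _ a] exI[of _ b] exI[of _ xs]) auto
    next
      case False
      then obtain ys c d zs where "b # xs = ys @ c # d # zs" "\<theta> c \<le> m" "m < \<theta> d"
        using 3 by force
      then show ?thesis by (intro exI[of _ "a # ys"]) auto
    qed
  qed auto
  then show ?thesis using that by blast
qed

lemma ends_notin_path_edges:
  assumes "distinct (x # p @ [y])" "p \<noteq> []"
  shows "{x, y} \<notin> path_edges (x # p @ [y])"
proof
  assume "{x, y} \<in> path_edges (x # p @ [y])"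
  then obtain ys a b zs where ab: "{x, y} = {a, b}" and s: "x # p @ [y] = ys @ a # b # zs"
    by (rule path_edgesE)
  have d: "distinct (ys @ a # b # zs)" using assms(1) unfolding s .
  have h: "hd (ys @ a # b # zs) = x" unfolding s[symmetric] by simp
  have l: "last (b # zs) = y" using arg_cong[OF s, of last] by simp
  have len: "length (ys @ a # b # zs) > 2" using assms(2) unfolding s[symmetric] by (cases p) auto
  have "a \<noteq> y" using d l by (metis distinct.simps(2) distinct_append last_in_set list.distinct(1))
  then have "a = x" "b = y" using ab by (auto simp: doubleton_eq_iff)
  then have "ys = []" using d h by (cases ys) auto
  moreover have "zs = []" using d l \<open>b = y\<close> by (cases zs rule: rev_cases) auto
  ultimately show False using len by simp
qed

text \<open>An edge without inner vertices would have to join \<open>x\<close> to \<open>y\<close>,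
  which are not consecutive because \<open>p\<close> is non-empty.\<close>

lemma path_edge_inner_vertex:
  assumes "distinct (x # p @ [y])" "p \<noteq> []" "e \<in> path_edges (x # p @ [y])"
  shows "e \<inter> set p \<noteq> {}"
proof -
  obtain ys a b zs where e: "e = {a, b}" and s: "x # p @ [y] = ys @ a # b # zs"
    using assms(3) by (rule path_edgesE)
  have "a \<noteq> b" using assms(1) unfolding s by auto
  moreover have "{a, b} \<noteq> {x, y}" using ends_notin_path_edges[OF assms(1,2)] assms(3) e by metis
  moreover have "{a, b} \<subseteq> {x, y} \<union> set p" using path_edges_subset[OF assms(3)] e by auto
  ultimately show ?thesis using e by auto
qed

text \<open>The order of \<open>hd p\<close> and \<open>hd q\<close> matters: the component contains
  \<open>hd q\<close>, so both paths have their first inner vertex no later than its last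
  vertex.\<close>

lemma spanning_component:
  fixes \<theta> :: "'a \<Rightarrow> real"
  assumes p: "p \<noteq> []" and q: "q \<noteq> []" and disj: "set p \<inter> set q = {}"
    and inj: "inj_on \<theta> ({x, y} \<union> set p \<union> set q)"
    and x_min: "\<And>v. v \<in> insert y (set p \<union> set q) \<Longrightarrow> \<theta> x < \<theta> v"
    and hd_less: "\<theta> (hd p) < \<theta> (hd q)" "\<theta> (hd q) < \<theta> y"
  obtains C where "C \<subseteq> path_edges (x # p @ [y]) \<union> path_edges (x # q @ [y])"
    "{x, hd q} \<in> C" "\<exists>z \<in> \<Union>C. \<theta> y \<le> \<theta> z"
    "\<And>f. f \<in> C \<Longrightarrow> (\<lambda>e f. e \<in> C \<and> f \<in> C \<and> interleave \<theta> e f)\<^sup>*\<^sup>* {x, hd q} f"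
proof -
  define F where "F = path_edges (x # p @ [y]) \<union> path_edges (x # q @ [y])"
  define r where "r e f \<longleftrightarrow> e \<in> F \<and> f \<in> F \<and> interleave \<theta> e f" for e f
  define C where "C = {f. r\<^sup>*\<^sup>* {x, hd q} f}"
  \<comment> \<open>Chains for \<open>r\<close> run through all of \<open>F\<close>; the conclusion
    asks for chains that stay inside \<open>C\<close>.\<close>
  define rC where "rC = (\<lambda>e f. e \<in> C \<and> f \<in> C \<and> interleave \<theta> e f)"
  have e0F: "{x, hd q} \<in> F"
    using q unfolding F_def by (intro UnI2 path_edgesI[of _ "[]" _ _ "tl q @ [y]"]) simp
  have e0C: "{x, hd q} \<in> C" unfolding C_def by simp
  have CF: "C \<subseteq> F"
  proof
    fix f assume "f \<in> C"
    then have "r\<^sup>*\<^sup>* {x, hd q} f" unfolding C_def by simp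
    then show "f \<in> F" by induction (auto simp: e0F r_def)
  qed
  have conn: "rC\<^sup>*\<^sup>* {x, hd q} f" if "f \<in> C" for f
  proof -
    have "r\<^sup>*\<^sup>* {x, hd q} f" using that unfolding C_def by simp
    then show ?thesis
    proof induction
      case (step e f)
      then have "e \<in> C" "f \<in> C" unfolding C_def by auto
      then have "rC e f" using step unfolding rC_def r_def by auto
      then show ?case using step by simp
    qed simp
  qed
  \<comment> \<open>Reversed chains are used below, to walk from an edge at the last vertex
    \<open>M\<close> back to the chord at \<open>x\<close>.\<close>
  have "symp rC" unfolding rC_def by (auto intro!: sympI interleave_sym)
  then have conn': "rC\<^sup>*\<^sup>* f {x, hd q}" if "f \<in> C" for f
    using conn[OF that] by (metis sympD symp_rtranclp)
  have UC: "\<Union>C \<subseteq> {x, y} \<union> set p \<union> set q"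
    using CF path_edges_subset unfolding F_def by fastforce
  then have fin: "finite (\<Union>C)" by (rule finite_subset) simp
  have hdC: "hd q \<in> \<Union>C" using e0C by auto
  obtain M where M: "M \<in> \<Union>C" "\<And>v. v \<in> \<Union>C \<Longrightarrow> \<theta> v \<le> \<theta> M"
  proof -
    have "Max (\<theta> ` \<Union>C) \<in> \<theta> ` \<Union>C" using fin hdC by (intro Max_in) auto
    then obtain M where "M \<in> \<Union>C" "\<theta> M = Max (\<theta> ` \<Union>C)" by (metis imageE)
    then show ?thesis using that fin by (metis Max_ge finite_imageI imageI)
  qed
  have "\<theta> y \<le> \<theta> M"
  proof (rule ccontr)
    assume "\<not> \<theta> y \<le> \<theta> M"
    then have My: "\<theta> M < \<theta> y" by simp
    \<comment> \<open>The edge \<open>{a, b}\<close> obtained here is where the path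
      \<open>s\<close> passes the level of \<open>M\<close>. It turns out that \<open>a\<close> is
      \<open>M\<close> itself.\<close>
    have "M \<in> set s" if s: "s = p \<or> s = q" for s
    proof -
      have "s \<noteq> []" using s p q by auto
      then have "s @ [y] \<noteq> []" "\<theta> (hd (s @ [y])) \<le> \<theta> M" "\<theta> M < \<theta> (last (s @ [y]))"
        using s M(2)[OF hdC] hd_less My by auto
      then obtain ys a b zs where ab: "s @ [y] = ys @ a # b # zs" "\<theta> a \<le> \<theta> M" "\<theta> M < \<theta> b"
        by (rule list_crosses_level)
      have "a \<in> set (s @ [y])" unfolding ab(1) by simp
      moreover have "a \<noteq> y" using ab My by auto
      ultimately have a: "a \<in> set s" by simp
      have "\<theta> a = \<theta> M"
      proof (rule ccontr)
        assume "\<theta> a \<noteq> \<theta> M"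
        then have aM: "\<theta> a < \<theta> M" using ab by simp
        obtain eM where eM: "eM \<in> C" "M \<in> eM" using M by auto
        have "\<theta> x < \<theta> a" using x_min a s by auto
        moreover have "\<exists>v w. e = {v, w}" if "e \<in> C" for e
          using that CF unfolding F_def by (blast elim: path_edgesE)
        \<comment> \<open>\<open>M\<close> lies strictly between \<open>a\<close> and
          \<open>b\<close>, and \<open>x\<close> lies before \<open>a\<close>, so some edge of
          \<open>C\<close> interleaves with \<open>{a, b}\<close>. This puts \<open>b\<close> into
          the component, beyond its last vertex.\<close>
        ultimately obtain g where g: "g \<in> C" "interleave \<theta> g {a, b}"
          using interleave_separated[OF conn'[OF eM(1), unfolded rC_def] eM(1) _ eM(2) aM ab(3), of x]
          by auto
        have "x # s @ [y] = (x # ys) @ a # b # zs" using ab by simp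
        then have "{a, b} \<in> path_edges (x # s @ [y])" by (rule path_edgesI)
        then have "{a, b} \<in> F" unfolding F_def using s by auto
        then have "r g {a, b}" using g CF unfolding r_def by auto
        then have "{a, b} \<in> C" using g(1) unfolding C_def by auto
        then show False using M(2)[of b] ab by auto
      qed
      then show ?thesis using inj_onD[OF inj, of a M] a s UC M(1) by auto
    qed
    then show False using disj by blast
  qed
  then show ?thesis
    using that[of C] CF e0C M(1) conn unfolding F_def rC_def by blast
qed

text \<open>The chord from \<open>x\<close> to \<open>u'\<close> has \<open>u\<close> on one side,
  while \<open>C\<close> reaches a vertex at or after \<open>y\<close>, hence past
  \<open>u'\<close>, on the other.\<close>

lemma spanning_components_interleave:
  fixes \<theta> :: "'a \<Rightarrow> real"
  assumes "{x, u} \<in> C" "\<And>e. e \<in> C \<Longrightarrow> \<exists>p q. e = {p, q}"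
    and "\<And>f. f \<in> C \<Longrightarrow> (\<lambda>e f. e \<in> C \<and> f \<in> C \<and> interleave \<theta> e f)\<^sup>*\<^sup>* {x, u} f"
    and "\<exists>z \<in> \<Union>C. \<theta> y \<le> \<theta> z"
    and "\<theta> x < \<theta> u" "\<theta> u < \<theta> u'" "\<theta> u' < \<theta> y"
  shows "\<exists>g \<in> C. interleave \<theta> g {x, u'}"
proof -
  obtain z e where "e \<in> C" "z \<in> e" "\<theta> u' < \<theta> z" using assms by force
  then show ?thesis
    using interleave_separated[OF assms(3)[OF \<open>e \<in> C\<close>] assms(1,2), of u x u' z] assms(5-) by auto
qed

section \<open>Paths under a single subdivision step\<close>

text \<open>If \<open>L\<close> uses the subdivided edge, \<open>w\<close> is inserted there;
  otherwise \<open>L\<close> survives unchanged. The last conclusion serves to keep different paths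
  disjoint, and the length bound keeps their interiors non-empty.\<close>

lemma subdivide_path:
  assumes L: "distinct L" "successively (\<lambda>a b. (a, b) \<in> parcs D) L"
    and w: "w \<notin> set L"
  obtains L' where "distinct L'" "successively (\<lambda>a b. (a, b) \<in> parcs (subdivide D (c, d) w)) L'"
    "hd L' = hd L" "last L' = last L" "length L \<le> length L'"
    "set L' \<subseteq> insert w (set L)" "w \<in> set L' \<Longrightarrow> {c, d} \<in> path_edges L"
proof (cases "{c, d} \<in> path_edges L")
  case False
  have "successively (\<lambda>a b. (a, b) \<in> parcs (subdivide D (c, d) w)) L"
    unfolding successively_iff_split
  proof safe
    fix ys a b zs assume s: "L = ys @ a # b # zs"
    then have "(a, b) \<in> parcs D" using L(2) unfolding successively_iff_split by blast
    moreover have "{a, b} \<in> path_edges L" using s by (rule path_edgesI)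
    then have "(a, b) \<noteq> (c, d)" "(a, b) \<noteq> (d, c)" using False by (auto simp: insert_commute)
    ultimately show "(a, b) \<in> parcs (subdivide D (c, d) w)" by simp
  qed
  then show ?thesis using that[of L] L w by auto
next
  case True
  then obtain ys a b zs where ab: "{c, d} = {a, b}" and s: "L = ys @ a # b # zs"
    by (rule path_edgesE)
  \<comment> \<open>Since \<open>L\<close> is distinct, neither half of it contains both
    \<open>a\<close> and \<open>b\<close>, so no arc of a half is destroyed.\<close>
  have keep: "successively (\<lambda>a b. (a, b) \<in> parcs (subdivide D (c, d) w)) xs"
    if "successively (\<lambda>a b. (a, b) \<in> parcs D) xs" "\<not> {a, b} \<subseteq> set xs" for xs
    unfolding successively_iff_split
  proof safe
    fix us v v' vs assume s: "xs = us @ v # v' # vs"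
    then have "(v, v') \<in> parcs D" using that(1) unfolding successively_iff_split by blast
    moreover have "(v, v') \<noteq> (c, d)" "(v, v') \<noteq> (d, c)"
      using that(2) s ab by (auto simp: doubleton_eq_iff)
    ultimately show "(v, v') \<in> parcs (subdivide D (c, d) w)" by simp
  qed
  have "successively (\<lambda>a b. (a, b) \<in> parcs (subdivide D (c, d) w)) (ys @ [a])"
    "successively (\<lambda>a b. (a, b) \<in> parcs (subdivide D (c, d) w)) (b # zs)"
    using L unfolding s by (intro keep; auto simp: successively_append_iff)+
  moreover have "(a, w) \<in> parcs (subdivide D (c, d) w)" "(w, b) \<in> parcs (subdivide D (c, d) w)"
    using ab by (auto simp: doubleton_eq_iff)
  ultimately have "successively (\<lambda>a b. (a, b) \<in> parcs (subdivide D (c, d) w)) (ys @ a # w # b # zs)"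
    by (auto simp: successively_append_iff)
  moreover have "hd (ys @ a # w # b # zs) = hd L" unfolding s by (cases ys) auto
  ultimately show ?thesis
    using that[of "ys @ a # w # b # zs"] L w True unfolding s by auto
qed

section \<open>Systems of internally disjoint paths\<close>

text \<open>The list \<open>p v\<close> holds only the inner vertices of the path.\<close>
definition path_system :: "'a rel \<Rightarrow> 'a \<Rightarrow> 'a \<Rightarrow> 'v set \<Rightarrow> ('v \<Rightarrow> 'a list) \<Rightarrow> bool" where
  "path_system A x y V p \<longleftrightarrow>
     (\<forall>v \<in> V. p v \<noteq> [] \<and> distinct (x # p v @ [y]) \<and>
        successively (\<lambda>a b. (a, b) \<in> A) (x # p v @ [y])) \<and>
     (\<forall>v \<in> V. \<forall>v' \<in> V. v \<noteq> v' \<longrightarrow> set (p v) \<inter> set (p v') = {})"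

lemma path_systemD:
  assumes "path_system A x y V p" "v \<in> V"
  shows "p v \<noteq> []" "distinct (x # p v @ [y])" "successively (\<lambda>a b. (a, b) \<in> A) (x # p v @ [y])"
  using assms unfolding path_system_def by blast+

lemma path_system_disjoint:
  "path_system A x y V p \<Longrightarrow> v \<in> V \<Longrightarrow> v' \<in> V \<Longrightarrow> v \<noteq> v' \<Longrightarrow> set (p v) \<inter> set (p v') = {}"
  unfolding path_system_def by blast

lemma path_system_subset: "path_system A x y V p \<Longrightarrow> W \<subseteq> V \<Longrightarrow> path_system A x y W p"
  unfolding path_system_def by (meson in_mono)

text \<open>A shared edge would contain an inner vertex of the first path. On the second path it
  could be neither an inner vertex nor an end.\<close>

lemma path_system_edges_disjoint:
  assumes ps: "path_system A x y V p" and v: "v \<in> V" "v' \<in> V" "v \<noteq> v'"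
  shows "path_edges (x # p v @ [y]) \<inter> path_edges (x # p v' @ [y]) = {}"
proof -
  have False if e: "e \<in> path_edges (x # p v @ [y])" "e \<in> path_edges (x # p v' @ [y])" for e
  proof -
    obtain z where z: "z \<in> e" "z \<in> set (p v)"
      using path_edge_inner_vertex[OF path_systemD(2,1)[OF ps v(1)] e(1)] by blast
    then have "z \<in> set (x # p v' @ [y])" using path_edges_subset[OF e(2)] by blast
    moreover have "z \<notin> set (p v')" using z path_system_disjoint[OF ps v] by blast
    ultimately have "z = x \<or> z = y" by simp
    then show False using z path_systemD(2)[OF ps v(1)] by auto
  qed
  then show ?thesis by blast
qed

lemma (in pair_wf_digraph) successively_arcs_subset_verts:
  assumes "successively (\<lambda>a b. (a, b) \<in> parcs G) (a # xs)" "xs \<noteq> []"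
  shows "set (a # xs) \<subseteq> pverts G"
  using assms
proof (induction xs arbitrary: a)
  case (Cons b xs)
  then have "(a, b) \<in> parcs G" by simp
  then have "a \<in> pverts G" "b \<in> pverts G" by (auto dest: wellformed')
  then show ?case using Cons by (cases xs) auto
qed simp

lemma subdivision_path_system:
  assumes "subdivision_pair H D" "parcs H = {x, y} \<times> V \<union> V \<times> {x, y}"
    and "x \<noteq> y" "x \<notin> V" "y \<notin> V"
  shows "\<exists>p. path_system (parcs D) x y V p"
  using assms(1)
proof (induction rule: subdivision_pair_induct)
  case base
  \<comment> \<open>Before any subdivision, the path indexed by \<open>v\<close> has
    \<open>v\<close> as its only inner vertex.\<close>
  show ?case using assms(2-) by (intro exI[of _ "\<lambda>v. [v]"]) (auto simp: path_system_def)
next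
  case (divide e w D)
  obtain c d where e: "e = (c, d)" by (cases e)
  interpret D: pair_bidirected_digraph D
    using divide.hyps(3) by (rule bidirected_digraphI_subdivision)
  obtain p where ps: "path_system (parcs D) x y V p" using divide.IH by blast
  have "\<exists>p'. p' \<noteq> [] \<and> distinct (x # p' @ [y]) \<and>
      successively (\<lambda>a b. (a, b) \<in> parcs (subdivide D e w)) (x # p' @ [y]) \<and>
      set p' \<subseteq> insert w (set (p v)) \<and>
      (w \<in> set p' \<longrightarrow> {c, d} \<in> path_edges (x # p v @ [y]))" if v: "v \<in> V" for v
  proof -
    note P = path_systemD[OF ps v]
    have "w \<notin> set (x # p v @ [y])"
      using D.successively_arcs_subset_verts[OF P(3)] divide.hyps(2) by auto
    then obtain L where L: "distinct L"
        "successively (\<lambda>a b. (a, b) \<in> parcs (subdivide D e w)) L"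
        "hd L = x" "last L = y" "length (x # p v @ [y]) \<le> length L"
        "set L \<subseteq> insert w (set (x # p v @ [y]))"
        "w \<in> set L \<Longrightarrow> {c, d} \<in> path_edges (x # p v @ [y])"
      using subdivide_path[OF P(2,3), of w c d] e by auto
    obtain p' where p': "L = x # p' @ [y]"
    proof -
      obtain L1 where L1: "L = x # L1" using L(3,5) by (cases L) auto
      moreover have "L1 \<noteq> []" using L(5) L1 by auto
      ultimately have "L1 = butlast L1 @ [y]" using L(4) append_butlast_last_id[of L1] by simp
      then show ?thesis using that L1 by blast
    qed
    moreover have "p' \<noteq> []" using L(5) p' P(1) by (cases "p v") auto
    ultimately show ?thesis using L P(2) by (intro exI[of _ p']) auto
  qed
  then obtain p' where p': "\<And>v. v \<in> V \<Longrightarrow> p' v \<noteq> [] \<and> distinct (x # p' v @ [y]) \<and>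
      successively (\<lambda>a b. (a, b) \<in> parcs (subdivide D e w)) (x # p' v @ [y]) \<and>
      set (p' v) \<subseteq> insert w (set (p v)) \<and>
      (w \<in> set (p' v) \<longrightarrow> {c, d} \<in> path_edges (x # p v @ [y]))"
    by metis
  \<comment> \<open>The fresh vertex \<open>w\<close> enters only paths that used the edge
    \<open>{c, d}\<close>, and at most one path did.\<close>
  have "set (p' v) \<inter> set (p' v') = {}" if v: "v \<in> V" "v' \<in> V" "v \<noteq> v'" for v v'
  proof -
    have "\<not> (w \<in> set (p' v) \<and> w \<in> set (p' v'))"
      using path_system_edges_disjoint[OF ps v] p' v(1,2) by blast
    then show ?thesis
      using p'[OF v(1)] p'[OF v(2)] path_system_disjoint[OF ps v] by blast
  qed
  then show ?case using p' unfolding path_system_def by blast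
qed

lemma path_system_map:
  assumes ps: "path_system (parcs D) x y V p" and "pair_wf_digraph D"
    and inj: "inj_on \<phi> (pverts D)" and arc: "\<And>a b. (a, b) \<in> parcs D \<Longrightarrow> (\<phi> a, \<phi> b) \<in> A"
  shows "path_system A (\<phi> x) (\<phi> y) V (\<lambda>v. map \<phi> (p v))"
proof -
  interpret pair_wf_digraph D by fact
  have sub: "set (x # p v @ [y]) \<subseteq> pverts D" if "v \<in> V" for v
    using successively_arcs_subset_verts path_systemD(3)[OF ps that] by blast
  have "distinct (\<phi> x # map \<phi> (p v) @ [\<phi> y])" if "v \<in> V" for v
    using distinct_map[of \<phi> "x # p v @ [y]"] path_systemD(2)[OF ps that] inj_on_subset[OF inj sub[OF that]]
    by simp
  moreover have "successively (\<lambda>a b. (a, b) \<in> A) (\<phi> x # map \<phi> (p v) @ [\<phi> y])" if "v \<in> V" for v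
  proof -
    have "successively (\<lambda>a b. (\<phi> a, \<phi> b) \<in> A) (x # p v @ [y])"
      using path_systemD(3)[OF ps that] arc by (rule successively_mono) 
    then show ?thesis using successively_map[of "\<lambda>a b. (a, b) \<in> A" \<phi> "x # p v @ [y]"] by simp
  qed
  moreover have "set (map \<phi> (p v)) \<inter> set (map \<phi> (p v')) = {}"
    if v: "v \<in> V" "v' \<in> V" "v \<noteq> v'" for v v'
  proof -
    have "\<phi> ` (set (p v) \<inter> set (p v')) = \<phi> ` set (p v) \<inter> \<phi> ` set (p v')"
      using sub[OF v(1)] sub[OF v(2)] by (intro inj_on_image_Int[OF inj]) auto
    then show ?thesis using path_system_disjoint[OF ps v] by simp
  qed
  ultimately show ?thesis using path_systemD(1)[OF ps] unfolding path_system_def by simp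
qed

lemma topological_minor_path_system:
  assumes "topological_minor H G" "parcs H = {x, y} \<times> V \<union> V \<times> {x, y}"
    and "x \<noteq> y" "x \<notin> V" "y \<notin> V"
  shows "\<exists>x' y' p. path_system (parcs G) x' y' V p"
proof -
  obtain D S where sd: "subdivision_pair H D" and sg: "subgraph (with_proj S) (with_proj G)"
    and iso: "digraph_iso (with_proj D) (with_proj S)"
    using assms(1) unfolding topological_minor_def by blast
  interpret D: pair_bidirected_digraph D using sd by (rule bidirected_digraphI_subdivision)
  obtain hom where hom: "pre_digraph.digraph_isomorphism (with_proj D) hom"
    and S: "with_proj S = app_iso hom (with_proj D)"
    using iso unfolding digraph_iso_def by blast
  have inj: "inj_on (iso_verts hom) (pverts D)"
    using hom by (simp add: pre_digraph.digraph_isomorphism_def)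
  \<comment> \<open>Both digraphs are of the form \<open>with_proj\<close>, so the arc map of the
    isomorphism must act on both ends of an arc as its vertex map.\<close>
  have tl: "iso_tail hom = fst" "iso_head hom = snd" and ar: "parcs S = iso_arcs hom ` parcs D"
    using arg_cong[OF S, of tail] arg_cong[OF S, of head] arg_cong[OF S, of arcs] by simp_all
  have arc: "(iso_verts hom a, iso_verts hom b) \<in> parcs G" if "(a, b) \<in> parcs D" for a b
  proof -
    have "iso_arcs hom (a, b) = (iso_verts hom a, iso_verts hom b)"
      using hom that tl unfolding pre_digraph.digraph_isomorphism_def
      by (metis fst_conv snd_conv prod.collapse with_proj_simps(2,4,5))
    then have "(iso_verts hom a, iso_verts hom b) \<in> parcs S" using ar that by force
    then show ?thesis using sg by (auto simp: subgraph_def)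
  qed
  obtain p where "path_system (parcs D) x y V p"
    using subdivision_path_system[OF sd assms(2-)] by blast
  then show ?thesis using path_system_map[OF _ _ inj arc] D.pair_wf_digraph_axioms by blast
qed

section \<open>The complete minor\<close>

text \<open>\<open>Digraph_Component.connected\<close> means strong connectedness of the symmetric
  closure. The induction therefore builds walks from and to \<open>e0\<close>, through which any two
  members are joined.\<close>

lemma connected_crossing_subgraph:
  assumes "e0 \<in> C"
    and conn: "\<And>f. f \<in> C \<Longrightarrow> (\<lambda>e f. e \<in> C \<and> f \<in> C \<and> interleave \<theta> e f)\<^sup>*\<^sup>* e0 f"
    and arcs: "\<And>e f. e \<in> C \<Longrightarrow> f \<in> C \<Longrightarrow> interleave \<theta> e f \<Longrightarrow> (e, f) \<in> parcs X"
  shows "Digraph_Component.connected (induce_subgraph (with_proj X) C)"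
proof -
  define S where "S = mk_symmetric (induce_subgraph (with_proj X) C)"
  have arc: "(e, f) \<in> parcs S" "(f, e) \<in> parcs S"
    if "e \<in> C" "f \<in> C" "interleave \<theta> e f" for e f
    using that arcs unfolding S_def by (force simp: parcs_mk_symmetric)+
  have "(e0, f) \<in> rtrancl_on C (parcs S) \<and> (f, e0) \<in> rtrancl_on C (parcs S)" if "f \<in> C" for f
    using conn[OF that]
  proof induction
    case base
    then show ?case using assms(1) by simp
  next
    case (step e f)
    then have ef: "e \<in> C" "f \<in> C" "(e, f) \<in> parcs S" "(f, e) \<in> parcs S" using arc by auto
    show ?case
      using rtrancl_on_into_rtrancl_on[OF conjunct1[OF step.IH] ef(3,2)]
        converse_rtrancl_on_into_rtrancl_on[OF ef(4) conjunct2[OF step.IH] ef(2)] by blast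
  qed
  then have "(e, f) \<in> rtrancl_on C (parcs S)" if "e \<in> C" "f \<in> C" for e f
    using that rtrancl_on_trans by metis
  then show ?thesis
    using assms(1)
    by (auto simp: S_def Digraph_Component.connected_def strongly_connected_def reachable_def)
qed

lemma path_system_imp_complete_minor:
  fixes \<theta> :: "'a \<Rightarrow> real"
  assumes "pair_wf_digraph G"
    and inj: "inj_on \<theta> (pverts G)"
    and x_min: "\<And>v. v \<in> pverts G \<Longrightarrow> v \<noteq> x \<Longrightarrow> \<theta> x < \<theta> v"
    and cross: "\<And>e f. e \<in> edge_set G \<Longrightarrow> f \<in> edge_set G \<Longrightarrow> interleave \<theta> e f \<Longrightarrow> crosses pos e f"
    and ps: "path_system (parcs G) x y W p"
    and "finite W" "2 * t \<le> card W"
    and before_y: "\<And>v. v \<in> W \<Longrightarrow> \<theta> (hd (p v)) < \<theta> y"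
  shows "\<exists>K :: nat pair_pre_digraph. complete_digraph t (with_proj K) \<and> minor K (crossing_graph G pos)"
proof -
  interpret pair_wf_digraph G by fact
  have sub: "set (x # p v @ [y]) \<subseteq> pverts G" if "v \<in> W" for v
    using successively_arcs_subset_verts path_systemD(3)[OF ps that] by blast
  have edges: "path_edges (x # p v @ [y]) \<subseteq> edge_set G" if "v \<in> W" for v
  proof
    fix e assume "e \<in> path_edges (x # p v @ [y])"
    then obtain ys a b zs where e: "e = {a, b}" and s: "x # p v @ [y] = ys @ a # b # zs"
      by (rule path_edgesE)
    have "(a, b) \<in> parcs G" using path_systemD(3)[OF ps that] s successively_iff_split by metis
    then show "e \<in> edge_set G" unfolding edge_set_def e by blast
  qed
  \<comment> \<open>\<open>C\<close> is the component found for the paths \<open>v\<close> and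
    \<open>v'\<close>, and \<open>u\<close> is the far end of its starting chord at
    \<open>x\<close>.\<close>
  define good where "good v v' C u \<longleftrightarrow>
    C \<subseteq> path_edges (x # p v @ [y]) \<union> path_edges (x # p v' @ [y]) \<and>
    {x, u} \<in> C \<and> (\<exists>z \<in> \<Union>C. \<theta> y \<le> \<theta> z) \<and>
    (\<forall>f \<in> C. (\<lambda>e f. e \<in> C \<and> f \<in> C \<and> interleave \<theta> e f)\<^sup>*\<^sup>* {x, u} f) \<and>
    u \<in> set (p v) \<union> set (p v') \<and> \<theta> x < \<theta> u \<and> \<theta> u < \<theta> y" for v v' C u
  have ordered: "\<exists>C u. good v v' C u"
    if v: "v \<in> W" "v' \<in> W" "v \<noteq> v'" and less: "\<theta> (hd (p v)) < \<theta> (hd (p v'))" for v v'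
  proof -
    note P = path_systemD[OF ps v(1)] and P' = path_systemD[OF ps v(2)]
    have s: "{x, y} \<union> set (p v) \<union> set (p v') \<subseteq> pverts G" using sub[OF v(1)] sub[OF v(2)] by auto
    have x: "\<theta> x < \<theta> z" if "z \<in> insert y (set (p v) \<union> set (p v'))" for z
      using that x_min s P(2) P'(2) by auto
    obtain C where C: "C \<subseteq> path_edges (x # p v @ [y]) \<union> path_edges (x # p v' @ [y])"
      "{x, hd (p v')} \<in> C" "\<exists>z \<in> \<Union>C. \<theta> y \<le> \<theta> z"
      "\<And>f. f \<in> C \<Longrightarrow> (\<lambda>e f. e \<in> C \<and> f \<in> C \<and> interleave \<theta> e f)\<^sup>*\<^sup>* {x, hd (p v')} f"
      using spanning_component[OF P(1) P'(1) path_system_disjoint[OF ps v] inj_on_subset[OF inj s]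
          x less before_y[OF v(2)]] by blast
    have "hd (p v') \<in> set (p v')" using P'(1) by simp
    moreover from this have "\<theta> x < \<theta> (hd (p v'))" using x by blast
    ultimately have "good v v' C (hd (p v'))" using C before_y[OF v(2)] unfolding good_def by simp
    then show ?thesis by blast
  qed
  have pair: "\<exists>C u. good v v' C u" if v: "v \<in> W" "v' \<in> W" "v \<noteq> v'" for v v'
  proof -
    have h: "hd (p v) \<in> set (p v)" "hd (p v') \<in> set (p v')"
      using path_systemD(1)[OF ps] v by simp_all
    then have "hd (p v) \<noteq> hd (p v')" using path_system_disjoint[OF ps v] by auto
    then have "\<theta> (hd (p v)) \<noteq> \<theta> (hd (p v'))"
      using inj_onD[OF inj, of "hd (p v)" "hd (p v')"] h sub[OF v(1)] sub[OF v(2)] by auto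
    then consider "\<theta> (hd (p v)) < \<theta> (hd (p v'))" | "\<theta> (hd (p v')) < \<theta> (hd (p v))" by linarith
    then show ?thesis
    proof cases
      case 1
      then show ?thesis by (rule ordered[OF v])
    next
      case 2
      \<comment> \<open>The two paths enter \<open>good\<close> only through unions, so they may be
        exchanged.\<close>
      show ?thesis using ordered[OF v(2,1) v(3)[symmetric] 2] unfolding good_def by (simp only: Un_commute)
    qed
  qed
  \<comment> \<open>Enumerate \<open>W\<close> and pair the paths with indices \<open>2 * k\<close>
    and \<open>2 * k + 1\<close>; the \<open>k\<close>-th pair yields the branch set
    \<open>B k\<close>.\<close>
  obtain h where h: "bij_betw h {0..<card W} W"
    using ex_bij_betw_nat_finite[OF \<open>finite W\<close>] by blast
  have hW: "h i \<in> W" if "i < 2 * t" for i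
    using that h \<open>2 * t \<le> card W\<close> by (auto simp: bij_betw_def)
  have h_inj: "h i = h j \<longleftrightarrow> i = j" if "i < 2 * t" "j < 2 * t" for i j
    using that h \<open>2 * t \<le> card W\<close> by (auto simp: bij_betw_def inj_on_def)
  have "\<exists>C u. good (h (2 * k)) (h (2 * k + 1)) C u" if "k < t" for k
    using that by (intro pair hW) (auto simp: h_inj)
  then obtain B u where "\<And>k. k < t \<Longrightarrow> good (h (2 * k)) (h (2 * k + 1)) (B k) (u k)"
    by metis
  note good = this[unfolded good_def]
  have B_sub: "B k \<subseteq> path_edges (x # p (h (2 * k)) @ [y]) \<union> path_edges (x # p (h (2 * k + 1)) @ [y])"
    and xu: "{x, u k} \<in> B k" and far: "\<exists>z \<in> \<Union>(B k). \<theta> y \<le> \<theta> z"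
    and conn: "\<And>f. f \<in> B k \<Longrightarrow>
      (\<lambda>e f. e \<in> B k \<and> f \<in> B k \<and> interleave \<theta> e f)\<^sup>*\<^sup>* {x, u k} f"
    and u_on: "u k \<in> set (p (h (2 * k))) \<union> set (p (h (2 * k + 1)))"
    and u_less: "\<theta> x < \<theta> (u k)" "\<theta> (u k) < \<theta> y" if "k < t" for k
    using good[OF that] by simp_all
  have B_edges: "B k \<subseteq> edge_set G" if "k < t" for k
    using B_sub[OF that] edges[OF hW[of "2 * k"]] edges[OF hW[of "2 * k + 1"]] that by auto
  have other: "h i \<noteq> h j" if "k < t" "l < t" "k \<noteq> l" "i \<in> {2 * k, 2 * k + 1}" "j \<in> {2 * l, 2 * l + 1}"
    for k l i j
    using that by (subst h_inj) auto
  have B_disj: "B k \<inter> B l = {}" if kl: "k < t" "l < t" "k \<noteq> l" for k l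
  proof -
    have "path_edges (x # p (h i) @ [y]) \<inter> path_edges (x # p (h j) @ [y]) = {}"
      if "i \<in> {2 * k, 2 * k + 1}" "j \<in> {2 * l, 2 * l + 1}" for i j
      using that kl by (intro path_system_edges_disjoint[OF ps hW hW other[OF kl that]]) auto
    from this[of "2 * k" "2 * l"] this[of "2 * k" "2 * l + 1"]
      this[of "2 * k + 1" "2 * l"] this[of "2 * k + 1" "2 * l + 1"]
    show ?thesis using B_sub[OF kl(1)] B_sub[OF kl(2)] by simp blast
  qed
  have u_verts: "u k \<in> pverts G" if "k < t" for k
    using u_on[OF that] sub[OF hW[of "2 * k"]] sub[OF hW[of "2 * k + 1"]] that by auto
  \<comment> \<open>Distinct angles allow any two branch sets to be ordered by their
    \<open>u\<close>; the one with the smaller angle then meets the other's chord at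
    \<open>x\<close>.\<close>
  have u_neq: "\<theta> (u k) \<noteq> \<theta> (u l)" if kl: "k < t" "l < t" "k \<noteq> l" for k l
  proof -
    have "set (p (h i)) \<inter> set (p (h j)) = {}"
      if "i \<in> {2 * k, 2 * k + 1}" "j \<in> {2 * l, 2 * l + 1}" for i j
      using that kl by (intro path_system_disjoint[OF ps hW hW other[OF kl that]]) auto
    from this[of "2 * k" "2 * l"] this[of "2 * k" "2 * l + 1"]
      this[of "2 * k + 1" "2 * l"] this[of "2 * k + 1" "2 * l + 1"]
    have "u k \<noteq> u l" using u_on[OF kl(1)] u_on[OF kl(2)] by auto
    then show ?thesis using inj_onD[OF inj] u_verts kl by blast
  qed
  let ?X = "crossing_graph G pos"
  have arcs: "(e, f) \<in> parcs ?X" "(f, e) \<in> parcs ?X"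
    if "e \<in> edge_set G" "f \<in> edge_set G" "interleave \<theta> e f" for e f
    using that interleave_imp_neq[of \<theta> e f] interleave_sym[of \<theta> e f] cross[of e f] cross[of f e]
    by (auto simp: crossing_graph_def)
  have touch: "\<exists>g \<in> B k. interleave \<theta> g {x, u l}" if "k < t" "l < t" "\<theta> (u k) < \<theta> (u l)" for k l
  proof (rule spanning_components_interleave[OF xu[OF that(1)] _ conn[OF that(1)] far[OF that(1)]
        u_less(1)[OF that(1)] that(3) u_less(2)[OF that(2)]])
    show "\<exists>v w. e = {v, w}" if "e \<in> B k" for e
      using B_edges[OF \<open>k < t\<close>] that unfolding edge_set_def by blast
  qed
  have B_arc: "\<exists>e \<in> B k. \<exists>f \<in> B l. (e, f) \<in> parcs ?X" if kl: "k < t" "l < t" "k \<noteq> l" for k l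
  proof (cases "\<theta> (u k) < \<theta> (u l)")
    case True
    then obtain g where "g \<in> B k" "interleave \<theta> g {x, u l}" using touch kl by blast
    moreover have "{x, u l} \<in> B l" using xu[OF kl(2)] .
    ultimately show ?thesis using arcs(1) B_edges kl by blast
  next
    case False
    then have "\<theta> (u l) < \<theta> (u k)" using u_neq[OF kl] by simp
    then obtain g where "g \<in> B l" "interleave \<theta> g {x, u k}" using touch kl by blast
    moreover have "{x, u k} \<in> B k" using xu[OF kl(1)] .
    ultimately show ?thesis using arcs(2) B_edges kl by blast
  qed
  have B_conn: "Digraph_Component.connected (induce_subgraph (with_proj ?X) (B k))" if "k < t" for k
    using connected_crossing_subgraph[OF xu[OF that] conn[OF that]] arcs(1) B_edges[OF that] by blast
  define K :: "nat pair_pre_digraph" where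
    "K = \<lparr>pverts = {..<t}, parcs = {(u, v). (u, v) \<in> {..<t} \<times> {..<t} \<and> u \<noteq> v}\<rparr>"
  have "complete_digraph t (with_proj K)"
    unfolding complete_digraph_pair_def by (simp add: K_def)
  moreover have "minor K ?X"
    unfolding minor_def
    using B_edges B_conn B_disj B_arc
    by (intro exI[of _ B]) (auto simp: K_def crossing_graph_def)
  ultimately show ?thesis by blast
qed

section \<open>Angular coordinates and the choice of orientation\<close>

lemma circular_drawing_angle:
  assumes "circular_drawing G pos" "x \<in> pverts G"
  obtains \<theta> z w where "w \<noteq> 0" "inj_on \<theta> (pverts G)" "\<theta> x = 0"
    "\<And>v. v \<in> pverts G \<Longrightarrow> 0 \<le> \<theta> v \<and> \<theta> v < 2 * pi"
    "\<And>v. v \<in> pverts G \<Longrightarrow> pos v = z + w * cis (\<theta> v)"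
proof -
  obtain z r where r: "r > 0" and S: "pos ` pverts G \<subseteq> sphere z r" and inj: "inj_on pos (pverts G)"
    using assms(1) unfolding circular_drawing_def by blast
  \<comment> \<open>Dividing by \<open>w\<close> after moving the centre to 0 sends \<open>x\<close>
    to 1, so angles are measured from \<open>x\<close>.\<close>
  define w where "w = pos x - z"
  define \<theta> where "\<theta> v = Arg2pi ((pos v - z) / w)" for v
  have n: "cmod (pos v - z) = r" if "v \<in> pverts G" for v
    using S that by (auto simp: dist_norm norm_minus_commute)
  have w: "cmod w = r" "w \<noteq> 0" using n[OF assms(2)] r unfolding w_def by auto
  have pos: "pos v = z + w * cis (\<theta> v)" if "v \<in> pverts G" for v
  proof -
    have "cmod ((pos v - z) / w) = 1" using n[OF that] w r by (simp add: norm_divide)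
    then have "(pos v - z) / w = cis (\<theta> v)"
      using Arg2pi[of "(pos v - z) / w"] unfolding is_Arg_def \<theta>_def cis_conv_exp by (metis mult_1 of_real_1)
    then show ?thesis using w(2) by (simp add: field_simps)
  qed
  then have "inj_on \<theta> (pverts G)" using inj by (metis inj_on_def)
  moreover have "\<theta> x = 0" using w(2) by (simp add: \<theta>_def w_def Arg2pi_eq_0)
  moreover have "0 \<le> \<theta> v \<and> \<theta> v < 2 * pi" for v
    using Arg2pi[of "(pos v - z) / w"] by (simp add: \<theta>_def)
  ultimately show ?thesis using that w(2) pos by blast
qed

theorem theorem4:
  fixes t :: nat and G :: "'a pair_pre_digraph"
  assumes "0 < t"
    and "pair_bidirected_digraph G"
    and "\<exists>pos. circular_drawing G pos \<and>
           \<not> (\<exists>K :: nat pair_pre_digraph.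
                 complete_digraph t (with_proj K) \<and> minor K (crossing_graph G pos))"
  shows "\<not> (\<exists>H :: nat pair_pre_digraph.
              complete_bipartite_digraph 2 (4 * t) (with_proj H) \<and> topological_minor H G)"
proof
  assume "\<exists>H :: nat pair_pre_digraph.
              complete_bipartite_digraph 2 (4 * t) (with_proj H) \<and> topological_minor H G"
  then obtain H :: "nat pair_pre_digraph" and U V where tm: "topological_minor H G"
    and UV: "U \<inter> V = {}" "card U = 2" "card V = 4 * t" "parcs H = U \<times> V \<union> V \<times> U"
    unfolding complete_bipartite_digraph_pair_def by blast
  obtain a b where U: "U = {a, b}" "a \<noteq> b" using UV(2) by (auto simp: card_2_iff)
  obtain x y p where ps: "path_system (parcs G) x y V p"
    using topological_minor_path_system[OF tm, of a b V] UV U by blast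
  obtain pos where drawing: "circular_drawing G pos"
    and no: "\<not> (\<exists>K :: nat pair_pre_digraph.
                 complete_digraph t (with_proj K) \<and> minor K (crossing_graph G pos))"
    using assms(3) by blast
  interpret pair_bidirected_digraph G by fact
  have sub: "set (x # p v @ [y]) \<subseteq> pverts G" if "v \<in> V" for v
    using successively_arcs_subset_verts path_systemD(3)[OF ps that] by blast
  \<comment> \<open>As \<open>t\<close> is positive there is at least one path, which shows that
    \<open>x\<close> and \<open>y\<close> are distinct vertices of \<open>G\<close>.\<close>
  have "finite V" "V \<noteq> {}" using UV(3) assms(1) card.infinite by fastforce+
  then have xy: "x \<in> pverts G" "y \<in> pverts G" "x \<noteq> y"
    using sub path_systemD(2)[OF ps] by fastforce+
  obtain \<theta> z w where ang: "w \<noteq> 0" "inj_on \<theta> (pverts G)" "\<theta> x = 0"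
    "\<And>v. v \<in> pverts G \<Longrightarrow> 0 \<le> \<theta> v \<and> \<theta> v < 2 * pi"
    "\<And>v. v \<in> pverts G \<Longrightarrow> pos v = z + w * cis (\<theta> v)"
    using circular_drawing_angle[OF drawing xy(1)] by metis
  have \<theta>_pos: "0 < \<theta> v" if "v \<in> pverts G" "v \<noteq> x" for v
    using ang(4)[OF that(1)] inj_onD[OF ang(2), of v x] that xy(1) ang(3) by force
  have edge_verts: "e \<subseteq> pverts G" if "e \<in> edge_set G" for e
    using that by (auto simp: edge_set_def dest: wellformed')
  \<comment> \<open>Stated for an arbitrary angle function and orientation, so as to apply to
    \<open>\<theta>\<close> and to its reflection.\<close>
  have small: "card W < 2 * t"
    if "W \<subseteq> V" "inj_on \<eta> (pverts G)" "\<eta> x = 0" "s = 1 \<or> s = -1"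
      "\<And>v. v \<in> pverts G \<Longrightarrow> v \<noteq> x \<Longrightarrow> 0 < \<eta> v \<and> \<eta> v < 2 * pi"
      "\<And>v. v \<in> pverts G \<Longrightarrow> pos v = z + w * cis (s * \<eta> v)"
      "\<And>v. v \<in> W \<Longrightarrow> \<eta> (hd (p v)) < \<eta> y"
    for W and \<eta> :: "'a \<Rightarrow> real" and s :: real
  proof (rule ccontr)
    assume "\<not> card W < 2 * t"
    have range: "0 \<le> \<eta> v \<and> \<eta> v < 2 * pi" if "v \<in> pverts G" for v
      using \<open>\<eta> x = 0\<close> that \<open>\<And>v. v \<in> pverts G \<Longrightarrow> v \<noteq> x \<Longrightarrow> 0 < \<eta> v \<and> \<eta> v < 2 * pi\<close>[of v]
      by (cases "v = x") auto
    have cr: "crosses pos e f" if "e \<in> edge_set G" "f \<in> edge_set G" "interleave \<eta> e f" for e f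
      using edge_verts[OF that(1)] edge_verts[OF that(2)] range \<open>w \<noteq> 0\<close>
        \<open>\<And>v. v \<in> pverts G \<Longrightarrow> pos v = z + w * cis (s * \<eta> v)\<close>
      by (intro interleave_imp_crosses[OF that(3) \<open>s = 1 \<or> s = -1\<close>, of pos z w]) auto
    have "\<exists>K :: nat pair_pre_digraph. complete_digraph t (with_proj K) \<and> minor K (crossing_graph G pos)"
      using that \<open>\<not> card W < 2 * t\<close> finite_subset[OF \<open>W \<subseteq> V\<close> \<open>finite V\<close>]
      by (intro path_system_imp_complete_minor[OF pair_wf_digraph_axioms that(2) _ cr
            path_system_subset[OF ps \<open>W \<subseteq> V\<close>]]) auto
    then show False using no by blast
  qed
  define W where "W = {v \<in> V. \<theta> (hd (p v)) < \<theta> y}"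
  have "card W < 2 * t"
    using ang \<theta>_pos by (intro small[of W \<theta> 1]) (auto simp: W_def)
  moreover have "card (V - W) < 2 * t"
  proof -
    \<comment> \<open>Reflection in the axis through \<open>x\<close>. The case distinction keeps
      \<open>x\<close> at angle 0 instead of \<open>2 * pi\<close>.\<close>
    define \<eta> where "\<eta> v = (if v = x then 0 else 2 * pi - \<theta> v)" for v
    have "inj_on \<eta> (pverts G)"
    proof (rule inj_onI)
      fix u v assume uv: "u \<in> pverts G" "v \<in> pverts G" "\<eta> u = \<eta> v"
      then show "u = v"
        using ang(4)[of u] ang(4)[of v] inj_onD[OF ang(2), of u v]
        by (auto simp: \<eta>_def split: if_splits)
    qed
    moreover have "cis (- (2 * pi)) = 1" by (simp add: complex_eq_iff)
    then have "pos v = z + w * cis (-1 * \<eta> v)" if "v \<in> pverts G" for v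
      using ang(3) ang(5)[OF that] cis_mult[of "\<theta> v" "- (2 * pi)"] by (auto simp: \<eta>_def)
    \<comment> \<open>Outside \<open>W\<close> the first inner vertex does not precede
      \<open>y\<close> and differs from it, so it comes after \<open>y\<close>; the reflection
      reverses this.\<close>
    moreover have "\<eta> (hd (p v)) < \<eta> y" if "v \<in> V - W" for v
    proof -
      have "hd (p v) \<in> set (p v)" using path_systemD(1)[OF ps] that by simp
      then have h: "hd (p v) \<in> pverts G" "hd (p v) \<noteq> x" "hd (p v) \<noteq> y"
        using sub path_systemD(2)[OF ps] that by fastforce+
      then have "\<theta> (hd (p v)) \<noteq> \<theta> y" using inj_onD[OF ang(2)] xy by blast
      then show ?thesis using that h xy by (auto simp: \<eta>_def W_def)
    qed
    ultimately show ?thesis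
      using ang(4) \<theta>_pos by (intro small[of "V - W" \<eta> "-1"]) (auto simp: \<eta>_def)
  qed
  \<comment> \<open>Two classes of fewer than \<open>2 * t\<close> paths each cannot make up all
    \<open>4 * t\<close>.\<close>
  moreover have "card V = card W + card (V - W)"
    using \<open>finite V\<close> by (subst card_Diff_subset) (auto simp: W_def card_mono finite_subset)
  ultimately show False using UV(3) by simp
qed

end
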